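(* For every integer $n\ge 2$ let $(G^1_n,\boldsymbol c^1_n)$ be the EWMCP instance defined in the context, and let $\mathscr C^1_n$ be any coloring of the vertices of $G^1_n$. Then $$\frac{\mathrm{UB}_1(G^1_n,\boldsymbol c^1_n,\mathscr C^1_n)}{\omega(G^1_n,\boldsymbol c^1_n)}\to+\infty\quad\text{as } n\to+\infty .$$
   Context: An instance of the Edge-Weighted Maximum Clique Problem (EWMCP) is a pair $(G,\boldsymbol c)$ where $G=(V,E)$ is a finite simple undirected graph and $\boldsymbol c=(c_e)_{e\in E}$ is a vector of nonnegative integer edge-weights. A clique is a set of pairwise adjacent vertices. For a clique $C$, $E[C]$ is the set of edges with both endpoints in $C$; its total edge-weight is $\sum_{e\in E[C]}c_e$. The number $\omega(G,\boldsymbol c)$ is the maximum total edge-weight of a clique of $G$. For $u\in V$, $\delta(u)\subseteq E$ is the set of edges incident to $u$. A coloring $\mathscr C$ of the vertices of $G$ is a partition of $V$ into disjoint non-empty independent sets (sets of pairwise non-adjacent vertices). First upper bound. $\mathrm{UB}_1(G,\boldsymbol c,\mathscr C)$ is the optimal value of the linear program, in real variables $\pi_I$ ($I\in\mathscr C$) and $\varrho_{eu},\varrho_{ev}$ (for each edge $e=\{u,v\}\in E$), $$\min \sum_{I\in\mathscr C}\pi_I$$ subject to $\varrho_{eu}+\varrho_{ev}=c_e$ for every $e=\{u,v\}\in E$; $\pi_I\ge\sum_{e\in\delta(u)}\varrho_{eu}$ for every $I\in\mathscr C$ and $u\in I$; and $\pi_I\ge0$, $\varrho_{eu}\ge0$,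 $\varrho_{ev}\ge0$ for all $I\in\mathscr C$ and all $e=\{u,v\}\in E$. The instances. For every integer $n\ge2$, $G^1_n=(V^1_n,E^1_n)$ has vertex set $\{1,\dots,2n\}$, partitioned into $C_1=\{1,\dots,n\}$ and $C_2=\{n+1,\dots,2n\}$. Its edges are: all edges between distinct vertices of $C_1$ and all edges between distinct vertices of $C_2$, each of weight $1$; and, for each $u\in C_1$, the edge $\{u,n+u\}$, of weight $\bar c=\frac{n(n-1)}{2}-1$. There are no other edges. These weights define $\boldsymbol c^1_n$. *)

theory Defs
  imports "HOL-Analysis.Analysis" "HOL-Library.Disjoint_Sets"
begin

type_synonym 'a graph = "'a set \<times> 'a set set"

abbreviation verts :: "'a graph \<Rightarrow> 'a set" where "verts G \<equiv> fst G"
abbreviation edges :: "'a graph \<Rightarrow> 'a set set" where "edges G \<equiv> snd G"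

definition finite_simple_graph :: "'a graph \<Rightarrow> bool" where
  "finite_simple_graph G \<longleftrightarrow>
     finite (verts G) \<and> (\<forall>e\<in>edges G. e \<subseteq> verts G \<and> card e = 2)"

definition clique :: "'a graph \<Rightarrow> 'a set \<Rightarrow> bool" where
  "clique G C \<longleftrightarrow> C \<subseteq> verts G \<and> (\<forall>u\<in>C. \<forall>v\<in>C. u \<noteq> v \<longrightarrow> {u, v} \<in> edges G)"

definition independent_set :: "'a graph \<Rightarrow> 'a set \<Rightarrow> bool" where
  "independent_set G I \<longleftrightarrow> I \<subseteq> verts G \<and> (\<forall>u\<in>I. \<forall>v\<in>I. {u, v} \<notin> edges G)"

definition coloring :: "'a graph \<Rightarrow> 'a set set \<Rightarrow> bool" where
  "coloring G \<C> \<longleftrightarrow> partition_on (verts G) \<C> \<and> (\<forall>I\<in>\<C>. independent_set G I)"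

definition induced_edges :: "'a graph \<Rightarrow> 'a set \<Rightarrow> 'a set set" where
  "induced_edges G C = {e \<in> edges G. e \<subseteq> C}"

definition incident_edges :: "'a graph \<Rightarrow> 'a \<Rightarrow> 'a set set" where
  "incident_edges G u = {e \<in> edges G. u \<in> e}"

text \<open>Edge weights are total functions; only their values on the edges of the graph matter.\<close>

definition omega :: "'a graph \<Rightarrow> ('a set \<Rightarrow> nat) \<Rightarrow> nat" where
  "omega G c = Max {\<Sum>e\<in>induced_edges G C. c e |C. clique G C}"

text \<open>The variables are \<open>\<pi> I\<close> for a color class \<open>I\<close>, and \<open>\<rho> e u\<close> for an edge \<open>e\<close> and an
  endpoint \<open>u\<close> of \<open>e\<close>; other values of the two functions are irrelevant.\<close>

definition UB1_feasible ::
  "'a graph \<Rightarrow> ('a set \<Rightarrow> nat) \<Rightarrow> 'a set set \<Rightarrow> ('a set \<Rightarrow> real) \<Rightarrow> ('a set \<Rightarrow> 'a \<Rightarrow> real) \<Rightarrow> bool"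
where
  "UB1_feasible G c \<C> \<pi> \<rho> \<longleftrightarrow>
     (\<forall>u v. {u, v} \<in> edges G \<longrightarrow> \<rho> {u, v} u + \<rho> {u, v} v = real (c {u, v})) \<and>
     (\<forall>I\<in>\<C>. \<forall>u\<in>I. \<pi> I \<ge> (\<Sum>e\<in>incident_edges G u. \<rho> e u)) \<and>
     (\<forall>I\<in>\<C>. \<pi> I \<ge> 0) \<and>
     (\<forall>e\<in>edges G. \<forall>u\<in>e. \<rho> e u \<ge> 0)"

definition UB1_values :: "'a graph \<Rightarrow> ('a set \<Rightarrow> nat) \<Rightarrow> 'a set set \<Rightarrow> real set" where
  "UB1_values G c \<C> = {\<Sum>I\<in>\<C>. \<pi> I |\<pi>. \<exists>\<rho>. UB1_feasible G c \<C> \<pi> \<rho>}"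

text \<open>The infimum is the optimal value because the program is feasible and bounded below, as
  shown by \<open>UB1_values_nonempty\<close> and \<open>UB1_values_bdd_below\<close>.\<close>

definition UB1 :: "'a graph \<Rightarrow> ('a set \<Rightarrow> nat) \<Rightarrow> 'a set set \<Rightarrow> real" where
  "UB1 G c \<C> = Inf (UB1_values G c \<C>)"

definition G1 :: "nat \<Rightarrow> nat graph" where
  "G1 n = ({1..2*n},
     {{u, v} |u v. u \<in> {1..n} \<and> v \<in> {1..n} \<and> u \<noteq> v} \<union>
     {{u, v} |u v. u \<in> {n+1..2*n} \<and> v \<in> {n+1..2*n} \<and> u \<noteq> v} \<union>
     {{u, n + u} |u. u \<in> {1..n}})"

text \<open>For \<open>n \<ge> 2\<close> both the division and the subtraction on natural numbers are exact
  (see \<open>c1_cross\<close>).\<close>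

definition c1 :: "nat \<Rightarrow> nat set \<Rightarrow> nat" where
  "c1 n e = (if e \<subseteq> {1..n} \<or> e \<subseteq> {n+1..2*n} then 1 else n * (n - 1) div 2 - 1)"

lemma UB1_values_nonempty:
  assumes "finite_simple_graph G"
  shows "UB1_values G c \<C> \<noteq> {}"
proof -
  have two: "u \<noteq> v" if "{u, v} \<in> edges G" for u v
    using assms that by (auto simp: finite_simple_graph_def)
  have finE: "finite (edges G)"
    using assms by (auto simp: finite_simple_graph_def intro: finite_subset[of _ "Pow (verts G)"])
  define \<rho> where "\<rho> = (\<lambda>(e::'a set) (u::'a). real (c e) / 2)"
  define \<pi> where "\<pi> = (\<lambda>I::'a set. \<Sum>e\<in>edges G. real (c e) / 2)"
  have "UB1_feasible G c \<C> \<pi> \<rho>"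
    unfolding UB1_feasible_def \<rho>_def \<pi>_def incident_edges_def
    by (auto intro!: sum_mono2 sum_nonneg simp: finE)
  then show ?thesis
    unfolding UB1_values_def by blast
qed

lemma UB1_values_bdd_below: "bdd_below (UB1_values G c \<C>)"
  by (rule bdd_belowI[of _ 0]) (auto simp: UB1_values_def UB1_feasible_def intro: sum_nonneg)

lemma finite_simple_graph_G1: "finite_simple_graph (G1 n)"
  by (auto simp: finite_simple_graph_def G1_def card_insert_if)

lemma c1_cross:
  assumes "n \<ge> 2" "u \<in> {1..n}"
  shows "real (c1 n {u, n + u}) = real n * (real n - 1) / 2 - 1"
proof -
  have "even (n * (n - 1))" by auto
  then have "real (n * (n - 1) div 2) = real n * (real n - 1) / 2"
    using assms by (simp add: real_of_nat_div of_nat_diff)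
  moreover have "n * (n - 1) div 2 \<ge> 1"
  proof -
    have "2 * 1 \<le> n * (n - 1)" using assms by (intro mult_le_mono) auto
    then show ?thesis by linarith
  qed
  ultimately show ?thesis
    using assms by (auto simp: c1_def of_nat_diff)
qed

end

theory Submission
  imports Defs
begin

text \<open>A feasible point of the linear program splits the weight of every edge between its two
  endpoints, so the vertex loads \<open>\<Sum>e\<in>incident_edges G u. \<rho> e u\<close> add up to the total edge
  weight of the whole graph. The value \<open>\<pi> I\<close> pays for the largest load in \<open>I\<close>, hence for at least
  the average one, and if no class has more than \<open>k\<close> vertices the program costs at least the total
  weight divided by \<open>k\<close> (\<open>total_weight_le_UB1\<close>). The vertices of \<open>G1 n\<close> are covered by two
  cliques, and a clique shares at most one vertex with a color class, so \<open>k = 2\<close> works for every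
  coloring (\<open>card_independent_set_G1_le\<close>).

  The \<open>n\<close> cross edges alone weigh \<open>n * ((n choose 2) - 1)\<close>, so the bound is of cubic order. A
  clique, however, is contained in one side, where it weighs at most \<open>n choose 2\<close>, or
  consists of a single cross edge, of weight \<open>(n choose 2) - 1\<close> (\<open>omega_G1_le\<close>). The ratio is
  therefore at least \<open>n / 4\<close> for \<open>n \<ge> 3\<close>.\<close>

section \<open>Bounds for general instances\<close>

lemma finite_edges:
  assumes "finite_simple_graph G"
  shows "finite (edges G)"
  using assms by (auto simp: finite_simple_graph_def intro: finite_subset[of _ "Pow (verts G)"])

lemma finite_clique_weights:
  assumes "finite_simple_graph G"
  shows "finite {\<Sum>e\<in>induced_edges G C. c e |C. clique G C}"
proof -
  have "{\<Sum>e\<in>induced_edges G C. c e |C. clique G C}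
      \<subseteq> (\<lambda>C. \<Sum>e\<in>induced_edges G C. c e) ` Pow (verts G)"
    by (auto simp: clique_def)
  then show ?thesis
    by (rule finite_subset) (use assms in \<open>simp add: finite_simple_graph_def\<close>)
qed

lemma omega_le:
  assumes "finite_simple_graph G"
    and "\<And>C. clique G C \<Longrightarrow> (\<Sum>e\<in>induced_edges G C. c e) \<le> b"
  shows "omega G c \<le> b"
proof -
  have "clique G {}"
    by (simp add: clique_def)
  then have "{\<Sum>e\<in>induced_edges G C. c e |C. clique G C} \<noteq> {}"
    by blast
  then show ?thesis
    unfolding omega_def using finite_clique_weights[OF assms(1)] assms(2)
    by (subst Max_le_iff) auto
qed

lemma edge_weight_le_omega:
  assumes G: "finite_simple_graph G" and e: "e \<in> edges G"
  shows "c e \<le> omega G c"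
proof -
  from G e have "e \<subseteq> verts G" "card e = 2"
    by (auto simp: finite_simple_graph_def)
  then have "clique G e"
    using e by (auto simp: clique_def card_2_iff insert_commute)
  then have "(\<Sum>f\<in>induced_edges G e. c f) \<le> omega G c"
    unfolding omega_def by (intro Max_ge finite_clique_weights[OF G]) auto
  moreover have "c e \<le> (\<Sum>f\<in>induced_edges G e. c f)"
    using e finite_edges[OF G] by (intro member_le_sum) (auto simp: induced_edges_def)
  ultimately show ?thesis
    by simp
qed

text \<open>This is the handshake identity for split weights: both sides sum \<open>\<rho> e u\<close> over all
  incident pairs of an edge and a vertex.\<close>

lemma sum_loads_eq_total_weight:
  assumes G: "finite_simple_graph G" and feas: "UB1_feasible G c \<C> \<pi> \<rho>"
  shows "(\<Sum>u\<in>verts G. \<Sum>e\<in>incident_edges G u. \<rho> e u) = (\<Sum>e\<in>edges G. real (c e))"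
proof -
  have finV: "finite (verts G)"
    using G by (simp add: finite_simple_graph_def)
  have "(\<Sum>u\<in>verts G. \<Sum>e\<in>incident_edges G u. \<rho> e u)
      = (\<Sum>e\<in>edges G. \<Sum>u\<in>{u \<in> verts G. u \<in> e}. \<rho> e u)"
    unfolding incident_edges_def by (rule sum.swap_restrict[OF finV finite_edges[OF G]])
  also have "\<dots> = (\<Sum>e\<in>edges G. real (c e))"
  proof (rule sum.cong[OF refl])
    fix e assume e: "e \<in> edges G"
    with G have "e \<subseteq> verts G" "card e = 2"
      by (auto simp: finite_simple_graph_def)
    then obtain u v where uv: "e = {u, v}" "u \<noteq> v"
      by (auto simp: card_2_iff)
    have "{w \<in> verts G. w \<in> e} = {u, v}"
      using \<open>e \<subseteq> verts G\<close> uv by auto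
    then show "(\<Sum>w\<in>{w \<in> verts G. w \<in> e}. \<rho> e w) = real (c e)"
      using feas e uv by (simp add: UB1_feasible_def)
  qed
  finally show ?thesis .
qed

text \<open>Averaging in place of linear programming duality: \<open>k * \<pi> I\<close> dominates the sum of the loads
  in \<open>I\<close>, and the classes partition the vertices.\<close>

lemma total_weight_le_UB1:
  assumes G: "finite_simple_graph G" and col: "coloring G \<C>"
    and k: "k > 0" "\<And>I. I \<in> \<C> \<Longrightarrow> card I \<le> k"
  shows "(\<Sum>e\<in>edges G. real (c e)) \<le> real k * UB1 G c \<C>"
proof -
  have part: "\<Union>\<C> = verts G" "disjoint \<C>"
    using col by (auto simp: coloring_def partition_on_def)
  have finI: "\<forall>I\<in>\<C>. finite I"
    using G part(1) by (auto simp: finite_simple_graph_def intro: finite_subset)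
  have bound: "(\<Sum>e\<in>edges G. real (c e)) / real k \<le> (\<Sum>I\<in>\<C>. \<pi> I)"
    if feas: "UB1_feasible G c \<C> \<pi> \<rho>" for \<pi> \<rho>
  proof -
    define load where "load = (\<lambda>u. \<Sum>e\<in>incident_edges G u. \<rho> e u)"
    have "(\<Sum>e\<in>edges G. real (c e)) = (\<Sum>u\<in>\<Union>\<C>. load u)"
      unfolding load_def part(1) using sum_loads_eq_total_weight[OF G feas] by simp
    also have "\<dots> = (\<Sum>I\<in>\<C>. \<Sum>u\<in>I. load u)"
      using sum.Union_disjoint[OF finI, of load] part(2) by (auto simp: disjoint_def)
    also have "\<dots> \<le> (\<Sum>I\<in>\<C>. real k * \<pi> I)"
    proof (rule sum_mono)
      fix I assume I: "I \<in> \<C>"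
      have "(\<Sum>u\<in>I. load u) \<le> real (card I) * \<pi> I"
        using feas I by (intro sum_bounded_above) (auto simp: UB1_feasible_def load_def)
      also have "\<dots> \<le> real k * \<pi> I"
        using feas I k(2)[OF I] by (intro mult_right_mono) (auto simp: UB1_feasible_def)
      finally show "(\<Sum>u\<in>I. load u) \<le> real k * \<pi> I" .
    qed
    also have "\<dots> = real k * (\<Sum>I\<in>\<C>. \<pi> I)"
      by (simp add: sum_distrib_left)
    finally show ?thesis
      using k(1) by (simp add: field_simps)
  qed
  have "(\<Sum>e\<in>edges G. real (c e)) / real k \<le> UB1 G c \<C>"
    unfolding UB1_def using UB1_values_nonempty[OF G] bound
    by (intro cInf_greatest) (auto simp: UB1_values_def)
  then show ?thesis
    using k(1) by (simp add: field_simps)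
qed

lemma card_independent_Int_clique_le:
  assumes "independent_set G I" "clique G C"
  shows "card (I \<inter> C) \<le> 1"
proof -
  have "\<forall>u\<in>I \<inter> C. \<forall>v\<in>I \<inter> C. u = v"
    using assms unfolding independent_set_def clique_def by blast
  then obtain w where "I \<inter> C \<subseteq> {w}"
    by blast
  then have "card (I \<inter> C) \<le> card {w}"
    by (intro card_mono) simp_all
  then show ?thesis
    by simp
qed

section \<open>The two-sided instances\<close>

lemma clique_sides_G1: "clique (G1 n) {1..n}" "clique (G1 n) {n+1..2*n}"
  by (fastforce simp: clique_def G1_def)+

lemma card_independent_set_G1_le:
  assumes "independent_set (G1 n) I"
  shows "card I \<le> 2"
proof -
  have "I \<subseteq> {1..2*n}"
    using assms by (simp add: independent_set_def G1_def)
  then have "I = I \<inter> {1..n} \<union> I \<inter> {n+1..2*n}"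
    by (auto simp: subset_iff)
  then have "card I \<le> card (I \<inter> {1..n}) + card (I \<inter> {n+1..2*n})"
    by (metis card_Un_le)
  then show ?thesis
    using card_independent_Int_clique_le[OF assms clique_sides_G1(1)]
      card_independent_Int_clique_le[OF assms clique_sides_G1(2)] by linarith
qed

lemma weight_within_side_le:
  assumes S: "S = {1..n} \<or> S = {n+1..2*n}" and C: "C \<subseteq> S"
  shows "(\<Sum>e\<in>induced_edges (G1 n) C. c1 n e) \<le> n choose 2"
proof -
  have "(\<Sum>e\<in>induced_edges (G1 n) C. c1 n e) = card (induced_edges (G1 n) C)"
    unfolding card_eq_sum
  proof (rule sum.cong[OF refl])
    fix e assume "e \<in> induced_edges (G1 n) C"
    with S C have "e \<subseteq> {1..n} \<or> e \<subseteq> {n+1..2*n}"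
      unfolding induced_edges_def by blast
    then show "c1 n e = 1"
      by (simp add: c1_def)
  qed
  also have "\<dots> \<le> card {e. e \<subseteq> S \<and> card e = 2}"
    using S C finite_simple_graph_G1[of n]
    by (intro card_mono) (auto simp: induced_edges_def finite_simple_graph_def)
  also have "\<dots> = n choose 2"
    using S by (auto simp: n_subsets)
  finally show ?thesis .
qed

text \<open>Since every vertex has exactly one neighbour on the opposite side, a clique that meets
  both sides cannot contain a third vertex.\<close>

lemma clique_meeting_both_sides:
  assumes C: "clique (G1 n) C" and u: "u \<in> C" "u \<in> {1..n}" and v: "v \<in> C" "v \<in> {n+1..2*n}"
  shows "C = {u, v}"
proof -
  have matched: "y = n + x" if "x \<in> C" "x \<in> {1..n}" "y \<in> C" "y \<in> {n+1..2*n}" for x y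
  proof -
    have "{x, y} \<in> edges (G1 n)"
      using C that by (auto simp: clique_def)
    then show ?thesis
      using that by (auto simp: G1_def doubleton_eq_iff)
  qed
  have "w \<in> {u, v}" if "w \<in> C" for w
  proof -
    have "w \<in> {1..n} \<or> w \<in> {n+1..2*n}"
      using C that by (auto simp: clique_def G1_def)
    then show ?thesis
      using matched[OF u v] matched[OF that _ v] matched[OF u that] by auto
  qed
  then show ?thesis
    using u v by auto
qed

lemma omega_G1_le:
  assumes n: "n \<ge> 2"
  shows "omega (G1 n) (c1 n) \<le> n choose 2"
proof (rule omega_le[OF finite_simple_graph_G1])
  fix C assume C: "clique (G1 n) C"
  then have CV: "C \<subseteq> {1..n} \<union> {n+1..2*n}"
    by (auto simp: clique_def G1_def)
  show "(\<Sum>e\<in>induced_edges (G1 n) C. c1 n e) \<le> n choose 2"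
  proof (cases "C \<subseteq> {1..n} \<or> C \<subseteq> {n+1..2*n}")
    case True
    then show ?thesis
      using weight_within_side_le by blast
  next
    case False
    then obtain u v where u: "u \<in> C" "u \<in> {1..n}" and v: "v \<in> C" "v \<in> {n+1..2*n}"
      using CV by blast
    have Cuv: "C = {u, v}" "card C = 2"
      using clique_meeting_both_sides[OF C u v] u v by auto
    have "e = C" if "e \<in> edges (G1 n)" "e \<subseteq> C" for e
      using that finite_simple_graph_G1[of n] Cuv
      by (intro card_subset_eq) (auto simp: finite_simple_graph_def)
    then have "induced_edges (G1 n) C \<subseteq> {C}"
      by (auto simp: induced_edges_def)
    then have "(\<Sum>e\<in>induced_edges (G1 n) C. c1 n e) \<le> (\<Sum>e\<in>{C}. c1 n e)"
      by (intro sum_mono2) auto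
    also have "\<dots> \<le> n choose 2"
      using False by (simp add: c1_def choose_two)
    finally show ?thesis .
  qed
qed

lemma omega_G1_pos:
  assumes "n \<ge> 2"
  shows "omega (G1 n) (c1 n) > 0"
proof -
  have "{1, 2} \<in> edges (G1 n)"
    unfolding G1_def snd_conv using assms
    by (intro UnI1 CollectI exI[of _ 1] exI[of _ 2]) simp
  from edge_weight_le_omega[OF finite_simple_graph_G1 this, of "c1 n"] show ?thesis
    using assms by (simp add: c1_def)
qed

lemma cross_weight_le_total_weight:
  assumes n: "n \<ge> 2"
  shows "real n * (real (n choose 2) - 1) \<le> (\<Sum>e\<in>edges (G1 n). real (c1 n e))"
proof -
  define cross where "cross = (\<lambda>u. {u, n + u}) ` {1..n}"
  have inj: "inj_on (\<lambda>u. {u, n + u}) {1..n}"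
    by (auto simp: inj_on_def doubleton_eq_iff)
  have "even (n * (n - 1))"
    by auto
  then have choose: "real (n choose 2) = real n * (real n - 1) / 2"
    using n by (simp add: choose_two real_of_nat_div of_nat_diff)
  have "(\<Sum>e\<in>cross. real (c1 n e)) = (\<Sum>u\<in>{1..n}. real (c1 n {u, n + u}))"
    unfolding cross_def using inj by (simp add: sum.reindex)
  also have "\<dots> = real n * (real (n choose 2) - 1)"
    using c1_cross[OF n] by (simp add: choose)
  finally have "real n * (real (n choose 2) - 1) = (\<Sum>e\<in>cross. real (c1 n e))"
    by simp
  also have "\<dots> \<le> (\<Sum>e\<in>edges (G1 n). real (c1 n e))"
    by (intro sum_mono2 finite_edges finite_simple_graph_G1) (auto simp: cross_def G1_def)
  finally show ?thesis .
qed

text \<open>For \<open>n = 2\<close> the cross edges have weight \<open>0\<close>. From \<open>n = 3\<close> on \<open>n choose 2\<close> is at least \<open>2\<close>,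
  so subtracting \<open>1\<close> loses at most half of it; this and the class size \<open>2\<close> give the
  denominator \<open>4\<close>.\<close>

lemma ratio_G1_ge:
  assumes n: "n \<ge> 3" and col: "coloring (G1 n) \<C>"
  shows "real n / 4 \<le> UB1 (G1 n) (c1 n) \<C> / real (omega (G1 n) (c1 n))"
proof -
  have pos: "real (omega (G1 n) (c1 n)) > 0"
    using omega_G1_pos n by simp
  have "n * (n - 1) \<ge> 3 * 2"
    using n by (intro mult_le_mono) auto
  then have "n choose 2 \<ge> 2"
    by (simp add: choose_two)
  then have half: "real (n choose 2) / 2 \<le> real (n choose 2) - 1"
    by simp
  have "real n / 4 * real (omega (G1 n) (c1 n)) \<le> real n / 4 * real (n choose 2)"
    using omega_G1_le n by (intro mult_left_mono) auto
  also have "\<dots> \<le> real n * (real (n choose 2) - 1) / 2"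
    using mult_left_mono[OF half, of "real n"] by simp
  also have "\<dots> \<le> UB1 (G1 n) (c1 n) \<C>"
  proof -
    have "card I \<le> 2" if "I \<in> \<C>" for I
      using col that card_independent_set_G1_le by (auto simp: coloring_def)
    from total_weight_le_UB1[OF finite_simple_graph_G1 col _ this, of "c1 n"] show ?thesis
      using cross_weight_le_total_weight[of n] n by simp
  qed
  finally show ?thesis
    using pos by (simp add: field_simps)
qed

theorem proposition1:
  fixes \<C> :: "nat \<Rightarrow> nat set set"
  assumes "\<And>n. n \<ge> 2 \<Longrightarrow> coloring (G1 n) (\<C> n)"
  shows "filterlim (\<lambda>n. UB1 (G1 n) (c1 n) (\<C> n) / real (omega (G1 n) (c1 n))) at_top sequentially"
proof (rule filterlim_at_top_mono)
  show "filterlim (\<lambda>n. real n / 4) at_top sequentially"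
    using filterlim_tendsto_pos_mult_at_top[OF tendsto_const, of "1/4::real",
        OF _ filterlim_real_sequentially] by simp
  show "\<forall>\<^sub>F n in sequentially.
      real n / 4 \<le> UB1 (G1 n) (c1 n) (\<C> n) / real (omega (G1 n) (c1 n))"
    using eventually_ge_at_top[of 3] by eventually_elim (rule ratio_G1_ge, simp_all add: assms)
qed

end
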